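(* Let $n\ge 2$ and let $X\subset\Omega_n$ be a hereditary subshift. Then $X$ is DC$1$-chaotic if and only if $X$ is not proximal.
   Context: $\mathbb{N}=\{1,2,\ldots\}$. For $n\ge 2$, $\Lambda_n=\{0,1,\ldots,n-1\}$ has the discrete topology and $\Omega_n=\Lambda_n^{\mathbb{N}}$ the product topology; $\sigma\colon\Omega_n\to\Omega_n$, $(\sigma(\omega))_i=\omega_{i+1}$, is the shift. $\Omega_n$ carries the metric $\rho(\omega,\gamma)=n^{-\min\{k\in\mathbb{N}:\omega_k\ne\gamma_k\}}$ for $\omega\neq\gamma$ and $\rho(\omega,\omega)=0$. A subshift is a nonempty closed set $X\subset\Omega_n$ with $\sigma(X)\subset X$. A subshift $X\subset\Omega_n$ is hereditary if whenever $\omega\in X$, $\omega'\in\Omega_n$ and $\omega'_i\le\omega_i$ for all $i\in\mathbb{N}$, then $\omega'\in X$. $X$ is proximal if $\liminf_{k\to\infty}\rho(\sigma^k(x),\sigma^k(y))=0$ for all $x,y\in X$. For $x,y\in X$ and $t\in\mathbb{R}$ put $F_{xy}(t)=\liminf_{m\to\infty}\frac1m\#\{0\le j\le m-1:\rho(\sigma^j(x),\sigma^j(y))<t\}$ and $F^*_{xy}(t)=\limsup_{m\to\infty}\frac1m\#\{0\le j\le m-1:\rho(\sigma^j(x),\sigma^j(y))<t\}$. A pair $(x,y)$ is DC$1$-scrambled if $F^*_{xy}(t)=1$ for all $t>0$ and $F_{xy}(s)=0$ for some $s>0$. $X$ is DC$1$-chaotic if there is an uncountable set $S\subset X$ such that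 every pair of distinct points of $S$ is DC$1$-scrambled. *)

theory Defs
  imports "HOL-Analysis.Analysis"
begin

text \<open>
  Sequences are indexed from \<open>0\<close>: the value \<open>\<omega> i\<close> is the symbol at position \<open>i + 1\<close> in
  \<open>{1, 2, \<dots>}\<close>. Accordingly, the exponent in \<open>rho\<close> is the successor of the first index
  of disagreement.
\<close>

definition Omega :: "nat \<Rightarrow> (nat \<Rightarrow> nat) set" where
  "Omega n = UNIV \<rightarrow> {..<n}"

definition Omega_topology :: "nat \<Rightarrow> (nat \<Rightarrow> nat) topology" where
  "Omega_topology n = product_topology (\<lambda>_. discrete_topology {..<n}) UNIV"

lemma topspace_Omega_topology: "topspace (Omega_topology n) = Omega n"
  by (auto simp: Omega_topology_def Omega_def)

definition shift :: "(nat \<Rightarrow> nat) \<Rightarrow> nat \<Rightarrow> nat" where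
  "shift \<omega> = (\<lambda>i. \<omega> (Suc i))"

definition rho :: "nat \<Rightarrow> (nat \<Rightarrow> nat) \<Rightarrow> (nat \<Rightarrow> nat) \<Rightarrow> real" where
  "rho n \<omega> \<gamma> =
    (if \<omega> = \<gamma> then 0 else 1 / real n ^ Suc (LEAST k. \<omega> k \<noteq> \<gamma> k))"

text \<open>Containment of \<open>X\<close> in \<open>Omega n\<close> is part of \<^const>\<open>closedin\<close>.\<close>

definition subshift :: "nat \<Rightarrow> (nat \<Rightarrow> nat) set \<Rightarrow> bool" where
  "subshift n X \<longleftrightarrow> X \<noteq> {} \<and> closedin (Omega_topology n) X \<and> shift ` X \<subseteq> X"

definition hereditary :: "nat \<Rightarrow> (nat \<Rightarrow> nat) set \<Rightarrow> bool" where
  "hereditary n X \<longleftrightarrow>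
    (\<forall>\<omega>\<in>X. \<forall>\<omega>'\<in>Omega n. (\<forall>i. \<omega>' i \<le> \<omega> i) \<longrightarrow> \<omega>' \<in> X)"

definition proximal :: "nat \<Rightarrow> (nat \<Rightarrow> nat) set \<Rightarrow> bool" where
  "proximal n X \<longleftrightarrow>
    (\<forall>x\<in>X. \<forall>y\<in>X.
      liminf (\<lambda>k. ereal (rho n ((shift ^^ k) x) ((shift ^^ k) y))) = 0)"

text \<open>For \<open>m = 0\<close> the frequency is \<open>0\<close> by convention; this affects neither limit below.\<close>

definition close_freq ::
  "nat \<Rightarrow> (nat \<Rightarrow> nat) \<Rightarrow> (nat \<Rightarrow> nat) \<Rightarrow> real \<Rightarrow> nat \<Rightarrow> real" where
  "close_freq n x y t m =
    real (card {j. j < m \<and> rho n ((shift ^^ j) x) ((shift ^^ j) y) < t}) / real m"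

definition lower_dist ::
  "nat \<Rightarrow> (nat \<Rightarrow> nat) \<Rightarrow> (nat \<Rightarrow> nat) \<Rightarrow> real \<Rightarrow> ereal" where
  "lower_dist n x y t = liminf (\<lambda>m. ereal (close_freq n x y t m))"

definition upper_dist ::
  "nat \<Rightarrow> (nat \<Rightarrow> nat) \<Rightarrow> (nat \<Rightarrow> nat) \<Rightarrow> real \<Rightarrow> ereal" where
  "upper_dist n x y t = limsup (\<lambda>m. ereal (close_freq n x y t m))"

definition DC1_scrambled :: "nat \<Rightarrow> (nat \<Rightarrow> nat) \<Rightarrow> (nat \<Rightarrow> nat) \<Rightarrow> bool" where
  "DC1_scrambled n x y \<longleftrightarrow>
    (\<forall>t>0. upper_dist n x y t = 1) \<and> (\<exists>s>0. lower_dist n x y s = 0)"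

definition DC1_chaotic :: "nat \<Rightarrow> (nat \<Rightarrow> nat) set \<Rightarrow> bool" where
  "DC1_chaotic n X \<longleftrightarrow>
    (\<exists>S\<subseteq>X. uncountable S \<and> (\<forall>x\<in>S. \<forall>y\<in>S. x \<noteq> y \<longrightarrow> DC1_scrambled n x y))"

end

theory Submission
  imports Defs
begin

text \<open>
  At scale \<open>1 / n ^ L\<close>, closeness of the shifted points means that the two sequences agree on a
  window of length \<open>L\<close>.

  If the lower distribution function of a pair vanishes at some scale, then the pair has arbitrarily
  long stretches without an agreement window, and a limit of the pair shifted to these stretches is
  a non-proximal pair.

  Conversely, let \<open>(x, y)\<close> be non-proximal. If \<open>x\<close> has arbitrarily long blocks of zeros, a limit of
  the shifts of \<open>y\<close> to these blocks has boundedly many consecutive zeros; otherwise a shift of \<open>x\<close>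
  already has. Call such a point \<open>z\<close>. By heredity \<open>X\<close> contains all points obtained from \<open>z\<close> by
  erasing it on some of the blocks \<open>[k!, (k+1)!)\<close>. Each block dwarfs everything before it, so a pair
  that agrees on infinitely many blocks, and infinitely often is erased in exactly one of its two
  components, is DC1-scrambled.
\<close>

section \<open>Agreement windows and the metric\<close>

definition agree :: "nat \<Rightarrow> (nat \<Rightarrow> nat) \<Rightarrow> (nat \<Rightarrow> nat) \<Rightarrow> nat \<Rightarrow> bool" where
  "agree L x y j \<longleftrightarrow> (\<forall>i<L. x (j + i) = y (j + i))"

lemma shift_funpow: "(shift ^^ k) x = (\<lambda>i. x (k + i))"
proof (induction k)
  case (Suc k)
  then show ?case by (simp add: shift_def)
qed simp

text \<open>If \<open>k\<close> is the first index of disagreement, the distance is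
  \<open>1 / n ^ (k + 1)\<close>. The strict bound then amounts to \<open>L < k + 1\<close>, so the
  window has length exactly \<open>L\<close>.\<close>

lemma rho_less_iff:
  assumes "n \<ge> 2"
  shows "rho n x y < 1 / real n ^ L \<longleftrightarrow> (\<forall>i<L. x i = y i)"
proof (cases "x = y")
  case True
  then show ?thesis using assms by (simp add: rho_def)
next
  case False
  define k where "k = (LEAST k. x k \<noteq> y k)"
  have "\<exists>k. x k \<noteq> y k" using False by auto
  then have neq: "x k \<noteq> y k" unfolding k_def by (rule LeastI_ex)
  have eq: "x i = y i" if "i < k" for i
    using not_less_Least that unfolding k_def by blast
  have "rho n x y < 1 / real n ^ L \<longleftrightarrow> real n ^ L < real n ^ Suc k"
    using False assms by (simp add: rho_def k_def field_simps)
  also have "\<dots> \<longleftrightarrow> L < Suc k"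
    using assms by (intro power_strict_increasing_iff) auto
  also have "\<dots> \<longleftrightarrow> (\<forall>i<L. x i = y i)"
    using neq eq by (meson less_Suc_eq_le not_le order.strict_trans2)
  finally show ?thesis .
qed

lemma rho_shift_less_iff:
  assumes "n \<ge> 2"
  shows "rho n ((shift ^^ j) x) ((shift ^^ j) y) < 1 / real n ^ L \<longleftrightarrow> agree L x y j"
  by (simp add: rho_less_iff[OF assms] agree_def shift_funpow)

lemma rho_nonneg: "rho n x y \<ge> 0"
  by (simp add: rho_def)

text \<open>Reduces every positive scale to a power of \<open>1 / n\<close>, where closeness is an
  agreement window; \<open>close_freq_mono\<close> carries frequency bounds back to the original
  scale.\<close>

lemma inverse_power_below:
  assumes "n \<ge> 2" "t > 0"
  obtains L where "1 / real n ^ L \<le> t"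
proof -
  obtain L where "(1 / real n) ^ L < t"
    using real_arch_pow_inv[of t "1 / real n"] assms by auto
  then show thesis using that[of L] by (simp add: power_one_over)
qed

lemma close_freq_agree:
  assumes "n \<ge> 2"
  shows "close_freq n x y (1 / real n ^ L) m = real (card {j. j < m \<and> agree L x y j}) / real m"
  by (simp add: close_freq_def rho_shift_less_iff[OF assms])

lemma close_freq_mono:
  assumes "s \<le> t"
  shows "close_freq n x y s m \<le> close_freq n x y t m"
  unfolding close_freq_def using assms
  by (intro divide_right_mono of_nat_mono card_mono) auto

lemma close_freq_le_1: "close_freq n x y t m \<le> 1"
proof -
  have "card {j. j < m \<and> rho n ((shift ^^ j) x) ((shift ^^ j) y) < t} \<le> card {..<m}"
    by (rule card_mono) auto
  then show ?thesis by (auto simp: close_freq_def divide_le_eq_1)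
qed

lemma liminf_rho_eq_0:
  assumes "n \<ge> 2" "\<And>L. \<exists>\<^sub>F k in sequentially. agree L x y k"
  shows "liminf (\<lambda>k. ereal (rho n ((shift ^^ k) x) ((shift ^^ k) y))) = 0" (is "liminf ?f = 0")
proof (rule antisym)
  show "0 \<le> liminf ?f"
    by (intro Liminf_bounded) (simp add: rho_nonneg)
  show "liminf ?f \<le> 0"
  proof (rule ccontr)
    assume "\<not> liminf ?f \<le> 0"
    then obtain c where c: "0 < ereal c" "ereal c < liminf ?f"
      by (meson ereal_dense2 not_le)
    obtain L where L: "1 / real n ^ L \<le> c"
      using inverse_power_below[OF assms(1)] c by auto
    have "\<forall>\<^sub>F k in sequentially. \<not> agree L x y k"
      using less_LiminfD[OF c(2)]
    proof eventually_elim
      case (elim k)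
      then show ?case using L rho_shift_less_iff[OF assms(1), of k x y L] by auto
    qed
    then show False using assms(2)[of L] by (simp add: frequently_def)
  qed
qed

lemma not_proximal_imp_eventually_not_agree:
  assumes "n \<ge> 2" "\<not> proximal n X"
  obtains x y L where "x \<in> X" "y \<in> X" "\<forall>\<^sub>F k in sequentially. \<not> agree L x y k"
  using assms liminf_rho_eq_0[OF assms(1)] unfolding proximal_def frequently_def by blast

lemma not_proximalI:
  assumes "n \<ge> 2" "x \<in> X" "y \<in> X" "\<And>k. \<not> agree L x y k"
  shows "\<not> proximal n X"
proof -
  have "1 / real n ^ L \<le> rho n ((shift ^^ k) x) ((shift ^^ k) y)" for k
    using assms(4)[of k] rho_shift_less_iff[OF assms(1), of k x y L] by linarith
  then have "ereal (1 / real n ^ L)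
      \<le> liminf (\<lambda>k. ereal (rho n ((shift ^^ k) x) ((shift ^^ k) y)))"
    by (intro Liminf_bounded) simp
  moreover have "0 < ereal (1 / real n ^ L)" using assms(1) by simp
  ultimately have "liminf (\<lambda>k. ereal (rho n ((shift ^^ k) x) ((shift ^^ k) y))) \<noteq> 0"
    by (auto dest: order.strict_trans2 simp del: ereal_less_eq ereal_less)
  then show ?thesis using assms(2,3) by (auto simp: proximal_def)
qed

section \<open>Compactness of subshifts\<close>

lemma subshift_shift_funpow:
  assumes "subshift n X" "x \<in> X"
  shows "(\<lambda>i. x (k + i)) \<in> X"
proof -
  have "(shift ^^ k) x \<in> X"
    using assms by (induction k) (auto simp: subshift_def)
  then show ?thesis by (simp add: shift_funpow)
qed

lemma subshift_subset_Omega: "subshift n X \<Longrightarrow> X \<subseteq> Omega n"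
  using closedin_subset[of "Omega_topology n" X] by (simp add: subshift_def topspace_Omega_topology)

lemma euclidean_nat_eq_discrete: "(euclidean :: nat topology) = discrete_topology UNIV"
  by (simp add: topology_eq open_discrete)

text \<open>Links the abstract product topology to the topology of the function type, so that
  \<open>compact\<close> and \<open>seq_compact\<close> apply.\<close>

lemma Omega_topology_eq: "Omega_topology n = subtopology euclidean (Omega n)"
proof -
  have "subtopology (product_topology (\<lambda>_. discrete_topology UNIV) UNIV) (Pi\<^sub>E UNIV (\<lambda>_. {..<n}))
      = product_topology (\<lambda>_. subtopology (discrete_topology UNIV) {..<n}) (UNIV :: nat set)"
    by (rule subtopology_product_topology)
  moreover have "(euclidean :: (nat \<Rightarrow> nat) topology)
      = product_topology (\<lambda>_. discrete_topology UNIV) UNIV"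
    by (simp flip: euclidean_nat_eq_discrete add: euclidean_product_topology)
  ultimately show ?thesis
    by (simp add: Omega_topology_def Omega_def PiE_UNIV_domain)
qed

lemma subshift_compact:
  assumes "subshift n X"
  shows "compact X"
proof -
  have "compact_space (Omega_topology n)"
    unfolding Omega_topology_def
    by (simp add: compact_space_product_topology compact_space_discrete_topology)
  then have "compactin (Omega_topology n) X"
    using assms closedin_compact_space by (auto simp: subshift_def)
  then show ?thesis
    by (simp add: Omega_topology_eq compactin_subtopology)
qed

text \<open>Compactness gives a convergent subsequence, and convergence in a discrete coordinate
  means being eventually equal to the limit.\<close>

lemma subshift_convergent_subsequence:
  assumes "subshift n X" "\<And>k. f k \<in> X"
  obtains x and r :: "nat \<Rightarrow> nat"
  where "x \<in> X" "strict_mono r" "\<And>i. \<forall>\<^sub>F k in sequentially. f (r k) i = x i"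
proof -
  have "seq_compact X"
    using subshift_compact[OF assms(1)] by (rule compact_imp_seq_compact)
  then obtain x r where x: "x \<in> X" "strict_mono r" "(f \<circ> r) \<longlonglongrightarrow> x"
    using assms(2) seq_compactE[of X f] by metis
  have "\<forall>\<^sub>F k in sequentially. f (r k) i = x i" for i
  proof -
    have "(\<lambda>k. (f \<circ> r) k i) \<longlonglongrightarrow> x i"
      using continuous_on_tendsto_compose[OF continuous_on_product_coordinates x(3)] by simp
    then show ?thesis by (simp add: tendsto_discrete)
  qed
  then show thesis using that x by blast
qed

lemma eventually_window:
  fixes f :: "nat \<Rightarrow> nat \<Rightarrow> nat"
  assumes "\<And>i. \<forall>\<^sub>F k in sequentially. f k i = x i"
  shows "\<forall>\<^sub>F k in sequentially. \<forall>i<L. f k (j + i) = x (j + i)"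
  using assms eventually_ball_finite[of "{..<L}" "\<lambda>k i. f k (j + i) = x (j + i)" sequentially]
  by (simp add: Ball_def)

subsection \<open>Scrambled pairs force non-proximality\<close>

text \<open>Each of the \<open>q\<close> disjoint intervals of length \<open>M\<close> below
  \<open>q * M\<close> contributes at least one point.\<close>

lemma card_ge_of_syndetic:
  fixes M q :: nat
  assumes "\<And>j. \<exists>i<M. P (j + i)"
  shows "q \<le> card {j. j < q * M \<and> P j}"
proof (induction q)
  case (Suc q)
  obtain i where i: "i < M" "P (q * M + i)" using assms by blast
  have "insert (q * M + i) {j. j < q * M \<and> P j} \<subseteq> {j. j < Suc q * M \<and> P j}"
    using i by auto
  then have "card (insert (q * M + i) {j. j < q * M \<and> P j}) \<le> card {j. j < Suc q * M \<and> P j}"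
    by (intro card_mono) auto
  then show ?case using Suc by simp
qed simp

text \<open>There are \<open>q = m div M \<ge> 1\<close> complete intervals of length
  \<open>M\<close> below \<open>m\<close>. The factor 2 absorbs the incomplete last one, as
  \<open>m < (q + 1) * M \<le> 2 * (q * M)\<close>.\<close>

lemma syndetic_freq_bound:
  fixes M :: nat
  assumes "\<And>j. \<exists>i<M. P (j + i)" "m \<ge> M"
  shows "1 / (2 * real M) \<le> real (card {j. j < m \<and> P j}) / real m"
proof -
  have M: "M > 0" using assms(1)[of 0] by auto
  define q where "q = m div M"
  have "q \<le> card {j. j < q * M \<and> P j}"
    by (rule card_ge_of_syndetic) (rule assms(1))
  also have "\<dots> \<le> card {j. j < m \<and> P j}"
    by (intro card_mono) (auto simp: q_def intro: less_le_trans)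
  finally have q: "real q \<le> real (card {j. j < m \<and> P j})" by simp
  have "q \<ge> 1" using M assms(2) by (simp add: q_def div_greater_zero_iff Suc_le_eq)
  moreover have "m < (q + 1) * M"
    using M by (simp add: q_def dividend_less_div_times)
  moreover from \<open>q \<ge> 1\<close> have "1 * M \<le> q * M" by (rule mult_le_mono1)
  ultimately have "m \<le> 2 * (q * M)" unfolding add_mult_distrib by linarith
  then have "real m \<le> real (2 * (q * M))"
    by (rule of_nat_mono)
  then have "1 / (2 * real M) \<le> real q / real m"
    using M assms(2) by (simp add: field_simps)
  also have "\<dots> \<le> real (card {j. j < m \<and> P j}) / real m"
    using q by (rule divide_right_mono) simp
  finally show ?thesis .
qed

text \<open>Otherwise, for each \<open>L\<close> some \<open>M\<close> exists such that agreement
  windows start in every interval of length \<open>M\<close>, and for a scale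
  \<open>1 / n ^ L \<le> s\<close> this bounds the frequencies below by
  \<open>1 / (2 * M) > 0\<close>.\<close>

lemma lower_dist_0_imp_long_gaps:
  assumes "n \<ge> 2" "s > 0" "lower_dist n x y s = 0"
  obtains L where "\<And>M. \<exists>j. \<forall>i<M. \<not> agree L x y (j + i)"
proof -
  obtain L where L: "1 / real n ^ L \<le> s" using inverse_power_below assms by blast
  have "\<exists>j. \<forall>i<M. \<not> agree L x y (j + i)" for M
  proof (rule ccontr)
    assume "\<not> ?thesis"
    then have syn: "\<exists>i<M. agree L x y (j + i)" for j by blast
    have "ereal (1 / (2 * real M)) \<le> lower_dist n x y s"
      unfolding lower_dist_def
    proof (intro Liminf_bounded eventually_sequentiallyI)
      fix m assume "M \<le> m"
      then have "1 / (2 * real M) \<le> close_freq n x y (1 / real n ^ L) m"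
        using syndetic_freq_bound[of M "agree L x y" m] syn
        by (simp add: close_freq_agree[OF assms(1)])
      then show "ereal (1 / (2 * real M)) \<le> ereal (close_freq n x y s m)"
        using close_freq_mono[OF L, of n x y m] by simp
    qed
    moreover have "M > 0" using syn[of 0] by auto
    ultimately show False using assms(3) by simp
  qed
  then show thesis by (rule that)
qed

lemma scrambled_pair_imp_not_proximal:
  assumes "n \<ge> 2" "subshift n X" "x \<in> X" "y \<in> X" "DC1_scrambled n x y"
  shows "\<not> proximal n X"
proof -
  obtain L where "\<And>M. \<exists>j. \<forall>i<M. \<not> agree L x y (j + i)"
    using assms(1,5) lower_dist_0_imp_long_gaps unfolding DC1_scrambled_def by metis
  then obtain J where J: "\<And>M i. i < M \<Longrightarrow> \<not> agree L x y (J M + i)" by metis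
  obtain x' r where x': "x' \<in> X" "strict_mono r"
    "\<And>i. \<forall>\<^sub>F k in sequentially. (\<lambda>i. x (J (r k) + i)) i = x' i"
    using subshift_convergent_subsequence[OF assms(2), of "\<lambda>k i. x (J k + i)"]
      subshift_shift_funpow[OF assms(2,3)] by blast
  \<comment> \<open>The second subsequence is drawn from the first, so both components converge
    along \<open>r (q l)\<close>.\<close>
  obtain y' q where y': "y' \<in> X" "strict_mono q"
    "\<And>i. \<forall>\<^sub>F k in sequentially. (\<lambda>i. y (J (r (q k)) + i)) i = y' i"
    using subshift_convergent_subsequence[OF assms(2), of "\<lambda>k i. y (J (r k) + i)"]
      subshift_shift_funpow[OF assms(2,4)] by blast
  have "\<not> agree L x' y' k" for k
  proof
    assume ag: "agree L x' y' k"
    have x'': "\<forall>\<^sub>F l in sequentially. x (J (r (q l)) + i) = x' i" for i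
      using eventually_subseq[OF y'(2) x'(3)[of i]] by simp
    have "\<forall>\<^sub>F l in sequentially. False"
      using eventually_window[of "\<lambda>l i. x (J (r (q l)) + i)" x' L k, OF x'']
        eventually_window[of "\<lambda>l i. y (J (r (q l)) + i)" y' L k, OF y'(3)]
        eventually_gt_at_top[of k]
    proof eventually_elim
      case (elim l)
      \<comment> \<open>Strict monotonicity gives \<open>r (q l) \<ge> l > k\<close>, so offset
        \<open>k\<close> falls inside the gap of length \<open>r (q l)\<close> that starts at
        \<open>J (r (q l))\<close>.\<close>
      have "k < r (q l)"
        using elim(3) seq_suble[OF x'(2), of "q l"] seq_suble[OF y'(2), of l] by linarith
      then have "\<not> agree L x y (J (r (q l)) + k)" by (rule J)
      then show ?case using elim ag by (auto simp: agree_def add.assoc)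
    qed
    then show False by simp
  qed
  then show ?thesis using not_proximalI assms(1) x'(1) y'(1) by blast
qed

subsection \<open>Non-proximality yields a syndetically nonzero point\<close>

lemma not_proximal_imp_syndetic_point:
  assumes "n \<ge> 2" "subshift n X" "\<not> proximal n X"
  obtains z L where "z \<in> X" "\<And>j. \<exists>i<L. z (j + i) \<noteq> 0"
proof -
  obtain x y L where xy: "x \<in> X" "y \<in> X" "\<forall>\<^sub>F k in sequentially. \<not> agree L x y k"
    using not_proximal_imp_eventually_not_agree assms by blast
  show thesis
  \<comment> \<open>A single \<open>M\<close> serves as threshold and as gap bound. The negation
    therefore yields, for every \<open>M\<close>, a block of \<open>M\<close> zeros of
    \<open>x\<close> starting at some \<open>K M \<ge> M\<close>.\<close>
  proof (cases "\<exists>M. \<forall>k\<ge>M. \<exists>i<M. x (k + i) \<noteq> 0")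
    case True
    then obtain M where "\<And>k. k \<ge> M \<Longrightarrow> \<exists>i<M. x (k + i) \<noteq> 0" by blast
    then have "\<exists>i<M. x (M + (j + i)) \<noteq> 0" for j
      by (metis add.assoc le_add1)
    then show thesis
      using that[of "\<lambda>i. x (M + i)" M] subshift_shift_funpow[OF assms(2) xy(1)] by blast
  next
    case False
    then obtain K where K: "\<And>M. K M \<ge> M" "\<And>M i. i < M \<Longrightarrow> x (K M + i) = 0" by metis
    obtain z r where z: "z \<in> X" "strict_mono r"
      "\<And>i. \<forall>\<^sub>F k in sequentially. (\<lambda>i. y (K (r k) + i)) i = z i"
      using subshift_convergent_subsequence[OF assms(2), of "\<lambda>k i. y (K k + i)"]
        subshift_shift_funpow[OF assms(2) xy(2)] by blast
    obtain N where N: "\<And>k. k \<ge> N \<Longrightarrow> \<not> agree L x y k"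
      using xy(3) by (auto simp: eventually_sequentially)
    \<comment> \<open>Where \<open>x\<close> vanishes, a window of zeros of \<open>y\<close> is an
      agreement window. Thus \<open>L\<close> consecutive zeros of \<open>z\<close> would produce
      agreement of \<open>x\<close> and \<open>y\<close> at arbitrarily late positions.\<close>
    have "\<exists>i<L. z (j + i) \<noteq> 0" for j
    proof (rule ccontr)
      assume zero: "\<not> (\<exists>i<L. z (j + i) \<noteq> 0)"
      have "\<forall>\<^sub>F l in sequentially. False"
        using eventually_window[of "\<lambda>l i. y (K (r l) + i)" z L j, OF z(3)]
          eventually_gt_at_top[of "N + j + L"]
      proof eventually_elim
        case (elim l)
        \<comment> \<open>This makes the zero block at \<open>K (r l)\<close> long enough to contain
          the window at offset \<open>j\<close>, and puts its start \<open>K (r l) \<ge> r l\<close>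
          past \<open>N\<close>.\<close>
        have l: "N + j + L < r l" using elim(2) seq_suble[OF z(2), of l] by linarith
        then have "x (K (r l) + (j + i)) = 0" if "i < L" for i
          using that by (intro K(2)) linarith
        then have "agree L x y (K (r l) + j)"
          using elim(1) zero by (auto simp: agree_def add.assoc)
        moreover have "K (r l) + j \<ge> N" using l K(1)[of "r l"] by linarith
        ultimately show ?case using N by blast
      qed
      then show False by simp
    qed
    then show thesis using that z(1) by blast
  qed
qed

subsection \<open>The scrambled set\<close>

text \<open>Below \<open>(k + 1)!\<close>, only the \<open>k!\<close> positions before the block and
  the last \<open>L\<close> positions can satisfy \<open>Q\<close>; bounding \<open>L\<close> by
  \<open>k! * L\<close> lets the factor \<open>k!\<close> cancel.\<close>

lemma block_freq_le:
  fixes k L :: nat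
  assumes "\<And>j. fact k \<le> j \<Longrightarrow> j + L < fact (Suc k) \<Longrightarrow> \<not> Q j"
  shows "real (card {j. j < fact (Suc k) \<and> Q j}) / real (fact (Suc k)) \<le> real (L + 1) / real (Suc k)"
proof -
  define a b :: nat where "a = fact k" and "b = fact (Suc k)"
  have a: "a \<ge> 1" and b: "b = a * Suc k" by (simp_all add: a_def b_def)
  have "j < a \<or> b - L \<le> j" if "Q j" for j
  proof -
    have "\<not> (a \<le> j \<and> j + L < b)" using assms[of j] that by (auto simp only: a_def b_def)
    then show ?thesis by linarith
  qed
  then have "{j. j < b \<and> Q j} \<subseteq> {..<a} \<union> {b - L..<b}"
    by (simp add: subset_iff)
  then have "card {j. j < b \<and> Q j} \<le> card ({..<a} \<union> {b - L..<b})"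
    by (intro card_mono) auto
  also have "\<dots> \<le> a + L"
    by (rule order.trans[OF card_Un_le]) simp
  also have "\<dots> \<le> a * (L + 1)"
    using mult_le_mono1[OF a, of L] by simp
  finally have "real (card {j. j < b \<and> Q j}) \<le> real (a * (L + 1))"
    by (rule of_nat_mono)
  then have "real (card {j. j < b \<and> Q j}) / real b \<le> real (a * (L + 1)) / real b"
    by (rule divide_right_mono) simp
  also have "\<dots> = real (L + 1) / real (Suc k)"
    unfolding b of_nat_mult using a by (intro mult_divide_mult_cancel_left) simp
  finally show ?thesis unfolding b_def .
qed

text \<open>\<open>Q\<close> is left general to serve both distribution functions: agreement is
  sparse for the lower one, disagreement for the upper one.\<close>

lemma frequently_sparse:
  fixes e :: real
  assumes "\<exists>\<^sub>F k in sequentially. \<forall>j. fact k \<le> j \<longrightarrow> j + L < fact (Suc k) \<longrightarrow> \<not> Q j" "e > 0"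
  shows "\<exists>\<^sub>F m in sequentially. m > 0 \<and> real (card {j. j < m \<and> Q j}) / real m < e"
  unfolding frequently_sequentially
proof
  fix N
  have "(\<lambda>k. real (L + 1) / real (Suc k)) \<longlonglongrightarrow> 0"
    using tendsto_mult_right_zero[OF LIMSEQ_inverse_real_of_nat, of "real (L + 1)"]
    by (simp add: divide_inverse)
  then have "\<forall>\<^sub>F k in sequentially. real (L + 1) / real (Suc k) < e \<and> k \<ge> N"
    using assms(2) by (intro eventually_conj order_tendstoD(2) eventually_ge_at_top)
  from frequently_ex[OF frequently_eventually_frequently[OF assms(1) this]]
  obtain k where k: "real (L + 1) / real (Suc k) < e" "k \<ge> N"
    "\<forall>j. fact k \<le> j \<longrightarrow> j + L < fact (Suc k) \<longrightarrow> \<not> Q j"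
    by blast
  have "N \<le> (fact (Suc k) :: nat)"
    using k(2) fact_ge_self[of "Suc k"] by linarith
  moreover have "real (card {j. j < (fact (Suc k) :: nat) \<and> Q j}) / real (fact (Suc k)) < e"
    using block_freq_le[of k L Q] k by (simp del: fact_Suc)
  ultimately show "\<exists>m\<ge>N. m > 0 \<and> real (card {j. j < m \<and> Q j}) / real m < e"
    using fact_gt_zero by blast
qed

lemma lower_dist_eq_0:
  assumes "n \<ge> 2"
    and "\<exists>\<^sub>F k in sequentially. \<forall>j. fact k \<le> j \<longrightarrow> j + L < fact (Suc k) \<longrightarrow> \<not> agree L x y j"
  shows "lower_dist n x y (1 / real n ^ L) = 0"
proof (rule antisym)
  show "0 \<le> lower_dist n x y (1 / real n ^ L)"
    unfolding lower_dist_def by (intro Liminf_bounded) (simp add: close_freq_def)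
  show "lower_dist n x y (1 / real n ^ L) \<le> 0"
  proof (rule ccontr)
    assume "\<not> lower_dist n x y (1 / real n ^ L) \<le> 0"
    then obtain c where c: "0 < ereal c" "ereal c < lower_dist n x y (1 / real n ^ L)"
      by (meson ereal_dense2 not_le)
    have "\<forall>\<^sub>F m in sequentially. c < real (card {j. j < m \<and> agree L x y j}) / real m"
      using less_LiminfD[OF c(2)[unfolded lower_dist_def]]
      by (simp add: close_freq_agree[OF assms(1)])
    then show False
      using frequently_ex[OF frequently_eventually_frequently[OF frequently_sparse[OF assms(2), of c]]] c(1)
      by fastforce
  qed
qed

lemma upper_dist_eq_1:
  assumes "n \<ge> 2" "t > 0"
    and "\<And>L. \<exists>\<^sub>F k in sequentially. \<forall>j. fact k \<le> j \<longrightarrow> j + L < fact (Suc k) \<longrightarrow> agree L x y j"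
  shows "upper_dist n x y t = 1"
proof (rule antisym)
  show "upper_dist n x y t \<le> 1"
    unfolding upper_dist_def by (intro Limsup_bounded) (simp add: close_freq_le_1)
  show "1 \<le> upper_dist n x y t"
  proof (rule ccontr)
    assume "\<not> 1 \<le> upper_dist n x y t"
    then obtain c where c: "upper_dist n x y t < ereal c" "ereal c < 1"
      by (meson ereal_dense2 not_le)
    obtain L where L: "1 / real n ^ L \<le> t" using inverse_power_below assms by blast
    \<comment> \<open>The upper bound is read off from the complementary frequency. At
      \<open>m = 0\<close> both quotients are 0 and the identity fails, which is why
      \<open>frequently_sparse\<close> also provides \<open>m > 0\<close>.\<close>
    have freq: "close_freq n x y (1 / real n ^ L) m
        = 1 - real (card {j. j < m \<and> \<not> agree L x y j}) / real m" if "m > 0" for m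
    proof -
      have "card {..<m} = card ({j. j < m \<and> agree L x y j} \<union> {j. j < m \<and> \<not> agree L x y j})"
        by (rule arg_cong[where f = card]) auto
      also have "\<dots> = card {j. j < m \<and> agree L x y j} + card {j. j < m \<and> \<not> agree L x y j}"
        by (rule card_Un_disjoint) auto
      finally have "real m = real (card {j. j < m \<and> agree L x y j})
          + real (card {j. j < m \<and> \<not> agree L x y j})"
        by simp
      then show ?thesis using that by (simp add: close_freq_agree[OF assms(1)] field_simps)
    qed
    have "\<forall>\<^sub>F m in sequentially. close_freq n x y t m < c"
      using Limsup_lessD[OF c(1)[unfolded upper_dist_def]] by simp
    then have "\<forall>\<^sub>F m in sequentially.
        \<not> (m > 0 \<and> real (card {j. j < m \<and> \<not> agree L x y j}) / real m < 1 - c)"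
    proof eventually_elim
      case (elim m)
      then show ?case using freq[of m] close_freq_mono[OF L, of n x y m] by auto
    qed
    then show False
      using frequently_sparse[of L "\<lambda>j. \<not> agree L x y j" "1 - c"] assms(3)[of L] c(2)
      by (simp add: frequently_def)
  qed
qed

section \<open>Masked points and their scrambling\<close>

lemma not_DC1_scrambled_self: "\<not> DC1_scrambled n x x"
proof
  assume "DC1_scrambled n x x"
  then obtain s where s: "s > 0" "lower_dist n x x s = 0"
    by (auto simp: DC1_scrambled_def)
  have "1 \<le> lower_dist n x x s"
    unfolding lower_dist_def
    by (intro Liminf_bounded eventually_mono[OF eventually_gt_at_top[of 0]])
      (use s(1) in \<open>simp add: close_freq_def rho_def one_ereal_def\<close>)
  then show False using s by simp
qed

text \<open>Every bit of \<open>\<alpha>\<close> is repeated in infinitely many blocks, and infinitely many blocks,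
  those with first component \<open>0\<close>, are off for all \<open>\<alpha>\<close>.\<close>

definition block_on :: "nat set \<Rightarrow> nat \<Rightarrow> bool" where
  "block_on \<alpha> k \<longleftrightarrow> (case fst (prod_decode k) of 0 \<Rightarrow> False | Suc i \<Rightarrow> i \<in> \<alpha>)"

text \<open>The blocks \<open>[k!, (k+1)!)\<close> are disjoint and miss only position 0, where the
  value defaults to 0. The result lies pointwise below \<open>z\<close>, as heredity
  demands.\<close>

definition masked :: "nat set \<Rightarrow> (nat \<Rightarrow> nat) \<Rightarrow> nat \<Rightarrow> nat" where
  "masked \<alpha> z i = (if \<exists>k. block_on \<alpha> k \<and> fact k \<le> i \<and> i < fact (Suc k) then z i else 0)"

lemma fact_block_unique:
  fixes i :: nat
  assumes "fact k \<le> i" "i < fact (Suc k)" "fact l \<le> i" "i < fact (Suc l)"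
  shows "k = l"
proof -
  have "\<not> Suc k \<le> l" "\<not> Suc l \<le> k"
    using assms fact_mono_nat[of "Suc k" l] fact_mono_nat[of "Suc l" k] by linarith+
  then show ?thesis by simp
qed

lemma masked_block:
  assumes "fact k \<le> i" "i < fact (Suc k)"
  shows "masked \<alpha> z i = (if block_on \<alpha> k then z i else 0)"
  using fact_block_unique[OF assms] assms unfolding masked_def by metis

text \<open>For fixed \<open>i\<close> the codes \<open>prod_encode (i, m) \<ge> m\<close> are
  unbounded.\<close>

lemma frequently_block:
  assumes "\<And>m. P (prod_encode (i, m))"
  shows "\<exists>\<^sub>F k in sequentially. P k"
  unfolding frequently_sequentially using assms le_prod_encode_2 by blast

lemma masked_scrambled:
  assumes "n \<ge> 2" "\<And>j. \<exists>i<L. z (j + i) \<noteq> 0" "\<alpha> \<noteq> \<beta>"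
  shows "DC1_scrambled n (masked \<alpha> z) (masked \<beta> z)"
  unfolding DC1_scrambled_def
proof (intro conjI allI impI)
  fix t :: real assume "t > 0"
  show "upper_dist n (masked \<alpha> z) (masked \<beta> z) t = 1"
  proof (rule upper_dist_eq_1[OF assms(1) \<open>t > 0\<close>])
    fix L
    show "\<exists>\<^sub>F k in sequentially. \<forall>j. fact k \<le> j \<longrightarrow> j + L < fact (Suc k)
        \<longrightarrow> agree L (masked \<alpha> z) (masked \<beta> z) j"
    proof (rule frequently_block[of _ 0], intro allI impI)
      fix m j :: nat
      define k where "k = prod_encode (0, m)"
      assume "fact (prod_encode (0, m)) \<le> j" "j + L < fact (Suc (prod_encode (0, m)))"
      then have j: "fact k \<le> j" "j + L < fact (Suc k)" by (simp_all only: k_def)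
      have off: "\<not> block_on \<alpha> k" "\<not> block_on \<beta> k" by (simp_all add: block_on_def k_def)
      show "agree L (masked \<alpha> z) (masked \<beta> z) j"
        using masked_block[of k] j off by (simp add: agree_def del: fact_Suc)
    qed
  qed
next
  \<comment> \<open>The blocks coded by \<open>(Suc i, m)\<close> are on for exactly one of the two
    sets. There one point equals \<open>z\<close> and the other is 0, so every nonzero entry of
    \<open>z\<close> is a disagreement.\<close>
  obtain i where i: "i \<in> \<alpha> \<longleftrightarrow> i \<notin> \<beta>" using assms(3) by blast
  have "lower_dist n (masked \<alpha> z) (masked \<beta> z) (1 / real n ^ L) = 0"
  proof (rule lower_dist_eq_0[OF assms(1)], rule frequently_block[of _ "Suc i"], intro allI impI)
    fix m j :: nat
    define k where "k = prod_encode (Suc i, m)"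
    assume "fact (prod_encode (Suc i, m)) \<le> j" "j + L < fact (Suc (prod_encode (Suc i, m)))"
    then have j: "fact k \<le> j" "j + L < fact (Suc k)" by (simp_all only: k_def)
    have on: "block_on \<alpha> k \<longleftrightarrow> \<not> block_on \<beta> k" using i by (simp add: block_on_def k_def)
    obtain d where d: "d < L" "z (j + d) \<noteq> 0" using assms(2) by blast
    have "masked \<alpha> z (j + d) \<noteq> masked \<beta> z (j + d)"
      using masked_block[of k "j + d"] j d on by (simp del: fact_Suc)
    then show "\<not> agree L (masked \<alpha> z) (masked \<beta> z) j" using d(1) by (auto simp: agree_def)
  qed
  then show "\<exists>s>0. lower_dist n (masked \<alpha> z) (masked \<beta> z) s = 0"
    using assms(1) by (intro exI[of _ "1 / real n ^ L"]) simp
qed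

lemma not_proximal_imp_DC1_chaotic:
  assumes "n \<ge> 2" "subshift n X" "hereditary n X" "\<not> proximal n X"
  shows "DC1_chaotic n X"
proof -
  obtain z L where z: "z \<in> X" "\<And>j. \<exists>i<L. z (j + i) \<noteq> 0"
    using not_proximal_imp_syndetic_point assms by blast
  have scr: "DC1_scrambled n (masked \<alpha> z) (masked \<beta> z)" if "\<alpha> \<noteq> \<beta>" for \<alpha> \<beta>
    using masked_scrambled assms(1) z(2) that by blast
  \<comment> \<open>A coincidence for distinct sets would be a point scrambled with itself.\<close>
  have "inj (\<lambda>\<alpha>. masked \<alpha> z)"
    using scr not_DC1_scrambled_self by (metis injI)
  moreover have "uncountable (UNIV :: nat set set)"
    using Cantors_theorem[of "UNIV :: nat set"] by (simp add: uncountable_def)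
  ultimately have "uncountable (range (\<lambda>\<alpha>. masked \<alpha> z))"
    by (auto dest: countable_image_inj_on)
  moreover have "masked \<alpha> z \<in> X" for \<alpha>
  proof -
    have "z i < n" for i
      using z(1) subshift_subset_Omega[OF assms(2)] by (auto simp: Omega_def)
    then have "masked \<alpha> z \<in> Omega n"
      using assms(1) by (simp add: Omega_def masked_def)
    then show ?thesis
      using assms(3) z(1) unfolding hereditary_def by (auto simp: masked_def)
  qed
  moreover have "DC1_scrambled n p q"
    if "p \<in> range (\<lambda>\<alpha>. masked \<alpha> z)" "q \<in> range (\<lambda>\<alpha>. masked \<alpha> z)" "p \<noteq> q" for p q
    using that scr by (metis imageE)
  ultimately show ?thesis
    unfolding DC1_chaotic_def by (intro exI[of _ "range (\<lambda>\<alpha>. masked \<alpha> z)"]) auto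
qed

theorem theorem24:
  fixes n :: nat and X :: "(nat \<Rightarrow> nat) set"
  assumes "n \<ge> 2"
    and "subshift n X"
    and "hereditary n X"
  shows "DC1_chaotic n X \<longleftrightarrow> \<not> proximal n X"
proof
  assume "DC1_chaotic n X"
  then obtain S where S: "S \<subseteq> X" "uncountable S"
    "\<forall>x\<in>S. \<forall>y\<in>S. x \<noteq> y \<longrightarrow> DC1_scrambled n x y"
    by (auto simp: DC1_chaotic_def)
  \<comment> \<open>Two distinct points of \<open>S\<close> are extracted, since one scrambled pair
    already excludes proximality.\<close>
  obtain x where x: "x \<in> S" using S(2) by (metis countable_empty ex_in_conv)
  have "uncountable (S - {x})" using S(2) by (simp add: uncountable_minus_countable)
  then obtain y where y: "y \<in> S" "y \<noteq> x" by (metis countable_empty ex_in_conv DiffD1 DiffD2 singletonI)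
  then have "DC1_scrambled n x y" using S(3) x by auto
  then show "\<not> proximal n X"
    using scrambled_pair_imp_not_proximal[OF assms(1,2), of x y] S(1) x y(1) by auto
next
  assume "\<not> proximal n X"
  then show "DC1_chaotic n X" by (rule not_proximal_imp_DC1_chaotic[OF assms])
qed

end
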